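(* For every $F\in\mathcal{R}[r]$, $$F=\iota\big(F(0)\big)+\sum_{a\in L}\int_0^{\#}\Big(\frac{\partial}{\partial a}F\Big)\,da,$$ where only finitely many summands are nonzero.
   Context: Let $L$ be a set of labels and $r\notin L$. $\mathcal{R}_0$ is the set of finite sequences $(a_1,\dots,a_n)$ ($n\ge0$; empty sequence $\emptyset$) of pairwise distinct elements of $L$, and $\mathcal{R}$ is the free abelian group on $\mathcal{R}_0$. $\mathcal{R}[r]$ is the free abelian group on symbols $A\otimes B$ with $A,B\in\mathcal{R}_0$ having disjoint entries ($A\otimes B$ is thought of as the sequence $A$, then $r$, then $B$). For $a\in L$, the linear map $\frac{\partial}{\partial a}$ on $\mathcal{R}[r]$ is given by $\frac{\partial}{\partial a}\big((a_1,\dots,a_m)\otimes(b_1,\dots,b_n)\big)=[m\ge1, a_m=a](a_1,\dots,a_{m-1})\otimes(b_1,\dots,b_n)-[n\ge1, b_1=a](a_1,\dots,a_m)\otimes(b_2,\dots,b_n)$ (Iverson brackets). The linear map $\iota:\mathcal{R}\to\mathcal{R}[r]$ is $\iota(a_1,\dots,a_n)=\sum_{k=0}^n(a_1,\dots,a_k)\otimes(a_{k+1},\dots,a_n)$. The value at $0$ is the linear map $\mathcal{R}[r]\to\mathcal{R}$ with $(A\otimes B)(0)=[A=\emptyset]\,B$. For $a\in L$ not occurring in $A,B$, the integral is the linear map $\int_0^{\#}(a_1,\dots,a_m)\otimes(b_1,\dots,b_n)\,da=\sum_{k=0}^{n}(a_1,\dots,a_m,a,b_1,\dots,b_k)\otimes(b_{k+1},\dots,b_n)$.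 *)

theory Defs
  imports "HOL-Algebra.Free_Abelian_Groups"
begin

definition seqs :: "'a set \<Rightarrow> 'a list set"  (* R_0 *)
  where "seqs L = {A. distinct A \<and> set A \<subseteq> L}"

text \<open>The pair \<open>(A, B)\<close> stands for the symbol \<open>A \<otimes> B\<close>; the extra label \<open>r\<close> is
  represented only by the position of the split between \<open>A\<close> and \<open>B\<close>.\<close>

definition rseqs :: "'a set \<Rightarrow> ('a list \<times> 'a list) set"
  where "rseqs L = {(A, B). A \<in> seqs L \<and> B \<in> seqs L \<and> set A \<inter> set B = {}}"

abbreviation RR :: "'a set \<Rightarrow> ('a list \<Rightarrow>\<^sub>0 int) monoid"  (* the group R *)
  where "RR L \<equiv> free_Abelian_group (seqs L)"

abbreviation RRr :: "'a set \<Rightarrow> ('a list \<times> 'a list \<Rightarrow>\<^sub>0 int) monoid"  (* the group R[r] *)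
  where "RRr L \<equiv> free_Abelian_group (rseqs L)"

definition pd :: "'a \<Rightarrow> ('a list \<times> 'a list \<Rightarrow>\<^sub>0 int) \<Rightarrow> ('a list \<times> 'a list \<Rightarrow>\<^sub>0 int)"
  where "pd a = frag_extend (\<lambda>(A, B).
      (if A \<noteq> [] \<and> last A = a then frag_of (butlast A, B) else 0)
    - (if B \<noteq> [] \<and> hd B = a then frag_of (A, tl B) else 0))"

definition iota :: "('a list \<Rightarrow>\<^sub>0 int) \<Rightarrow> ('a list \<times> 'a list \<Rightarrow>\<^sub>0 int)"
  where "iota = frag_extend (\<lambda>A. \<Sum>k\<le>length A. frag_of (take k A, drop k A))"

definition at0 :: "('a list \<times> 'a list \<Rightarrow>\<^sub>0 int) \<Rightarrow> ('a list \<Rightarrow>\<^sub>0 int)"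
  where "at0 = frag_extend (\<lambda>(A, B). if A = [] then frag_of B else 0)"

text \<open>The integral with respect to \<open>a\<close> is meant only for elements in which \<open>a\<close> does not
  occur, that is for elements of \<open>RRr (L - {a})\<close>; by the lemma \<open>pd_closed\<close> below, the
  \<open>a\<close>-derivative of any element of \<open>RRr L\<close> is of this kind.\<close>

definition integral0 :: "'a \<Rightarrow> ('a list \<times> 'a list \<Rightarrow>\<^sub>0 int) \<Rightarrow> ('a list \<times> 'a list \<Rightarrow>\<^sub>0 int)"
  where "integral0 a = frag_extend (\<lambda>(A, B).
      \<Sum>k\<le>length B. frag_of (A @ [a] @ take k B, drop k B))"

lemma frag_extend_closed:
  assumes "c \<in> carrier (free_Abelian_group S)"
    and "\<And>x. x \<in> S \<Longrightarrow> f x \<in> carrier (free_Abelian_group T)"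
  shows "frag_extend f c \<in> carrier (free_Abelian_group T)"
  using assms keys_frag_extend[of f c] by (fastforce simp: carrier_free_Abelian_group_iff)

lemma sum_frag_of_closed:
  assumes "\<And>k. k \<in> I \<Longrightarrow> g k \<in> T"
  shows "(\<Sum>k\<in>I. frag_of (g k)) \<in> carrier (free_Abelian_group T)"
  using assms keys_sum[of "\<lambda>k. frag_of (g k)" I]
  by (fastforce simp: carrier_free_Abelian_group_iff)

lemma pd_closed:
  assumes "F \<in> carrier (RRr L)"
  shows "pd a F \<in> carrier (RRr (L - {a}))"
  unfolding pd_def
proof (rule frag_extend_closed[OF assms], clarify)
  fix A B assume AB: "(A, B) \<in> rseqs L"
  have 1: "(butlast A, B) \<in> rseqs (L - {a})" if "A \<noteq> []" "last A = a"
    using that AB by (cases A rule: rev_cases) (auto simp: rseqs_def seqs_def)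
  have 2: "(A, tl B) \<in> rseqs (L - {a})" if "B \<noteq> []" "hd B = a"
    using that AB by (cases B) (auto simp: rseqs_def seqs_def)
  show "(if A \<noteq> [] \<and> last A = a then frag_of (butlast A, B) else 0)
    - (if B \<noteq> [] \<and> hd B = a then frag_of (A, tl B) else 0) \<in> carrier (RRr (L - {a}))"
    unfolding carrier_free_Abelian_group_iff
    by (rule order_trans[OF keys_diff]) (use 1 2 in auto)
qed

lemma iota_closed:
  assumes "F \<in> carrier (RR L)"
  shows "iota F \<in> carrier (RRr L)"
  unfolding iota_def
proof (rule frag_extend_closed[OF assms], rule sum_frag_of_closed)
  fix A k assume "A \<in> seqs L"
  then show "(take k A, drop k A) \<in> rseqs L"
    by (auto simp: rseqs_def seqs_def dest: in_set_takeD in_set_dropD)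
       (meson disjoint_iff order_refl set_take_disj_set_drop_if_distinct)
qed

lemma at0_closed:
  assumes "F \<in> carrier (RRr L)"
  shows "at0 F \<in> carrier (RR L)"
  unfolding at0_def
  by (rule frag_extend_closed[OF assms])
     (auto simp: carrier_free_Abelian_group_iff rseqs_def split: if_split_asm)

lemma integral0_closed:
  assumes "F \<in> carrier (RRr (L - {a}))" "a \<in> L"
  shows "integral0 a F \<in> carrier (RRr L)"
  unfolding integral0_def
proof (rule frag_extend_closed[OF assms(1)], clarify, rule sum_frag_of_closed)
  fix A B k assume "(A, B) \<in> rseqs (L - {a})"
  moreover have "set (take k B) \<inter> set (drop k B) = {}" if "distinct B"
    using that by (simp add: set_take_disj_set_drop_if_distinct)
  ultimately show "(A @ [a] @ take k B, drop k B) \<in> rseqs L"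
    using \<open>a \<in> L\<close> by (auto simp: rseqs_def seqs_def dest: in_set_takeD in_set_dropD)
qed

end

theory Submission
  imports Defs
begin

text \<open>By linearity it suffices to consider \<open>A \<otimes> B\<close>. Write \<open>T(A, B)\<close> for the sum of all
  \<open>A C \<otimes> D\<close> with \<open>B = C D\<close>. For \<open>a\<close> the last entry of \<open>A\<close>, the integral of the \<open>A\<close>-part of the
  derivative is \<open>T(A, B)\<close>; for \<open>a\<close> the first entry of \<open>B\<close>, that of the \<open>B\<close>-part is
  \<open>T(A a, tl B) = T(A, B) - A \<otimes> B\<close>. So the sum over \<open>a\<close> telescopes to \<open>A \<otimes> B\<close>, except that for
  \<open>A = \<emptyset>\<close> the term \<open>T(\<emptyset>, B)\<close> is missing, and this is \<open>\<iota>(B)\<close>.\<close>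

definition right_shifts :: "'a list \<Rightarrow> 'a list \<Rightarrow> ('a list \<times> 'a list \<Rightarrow>\<^sub>0 int)"
  where "right_shifts A B = (\<Sum>k\<le>length B. frag_of (A @ take k B, drop k B))"

lemma right_shifts_Nil: "right_shifts A [] = frag_of (A, [])"
  by (simp add: right_shifts_def)

text \<open>Splitting off the summand \<open>k = 0\<close> leaves the shifts in which
  \<open>b\<close> has already crossed over; this drives the telescoping.\<close>

lemma right_shifts_Cons:
  "right_shifts A (b # B) = frag_of (A, b # B) + right_shifts (A @ [b]) B"
  by (simp add: right_shifts_def sum.atMost_Suc_shift del: sum.atMost_Suc)

lemma integral0_frag_of: "integral0 a (frag_of (A, B)) = right_shifts (A @ [a]) B"
  by (simp add: integral0_def right_shifts_def)

lemma iota_frag_of: "iota (frag_of B) = right_shifts [] B"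
  by (simp add: iota_def right_shifts_def)

text \<open>Integration restores a label removed from the end of \<open>A\<close>, but moves one
  removed from the front of \<open>B\<close> over to \<open>A\<close>.\<close>

lemma integral0_pd_frag_of:
  "integral0 a (pd a (frag_of (A, B))) =
     (if A \<noteq> [] \<and> last A = a then right_shifts A B else 0)
   - (if B \<noteq> [] \<and> hd B = a then right_shifts (A @ [a]) (tl B) else 0)"
proof -
  have "integral0 a (x - y) = integral0 a x - integral0 a y" for x y
    by (simp add: integral0_def frag_extend_diff)
  moreover have "integral0 a 0 = 0"
    by (simp add: integral0_def)
  ultimately show ?thesis
    by (auto simp: pd_def integral0_frag_of)
qed

lemma iota_at0_frag_of:
  "iota (at0 (frag_of (A, B))) = (if A = [] then right_shifts [] B else 0)"
  by (simp add: at0_def iota_frag_of) (simp add: iota_def)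

lemma expansion_frag_of:
  assumes "finite N" "set A \<subseteq> N" "set B \<subseteq> N"
  shows "frag_of (A, B) = iota (at0 (frag_of (A, B)))
    + (\<Sum>a\<in>N. integral0 a (pd a (frag_of (A, B))))"
proof -
  have "(\<Sum>a\<in>N. if A \<noteq> [] \<and> last A = a then right_shifts A B else 0)
      = (if A \<noteq> [] then right_shifts A B else 0)"
    using assms by (cases A rule: rev_cases) auto
  \<comment> \<open>For \<open>B = []\<close> both sides are 0, as \<open>right_shifts A []\<close>
    is a single term; otherwise only \<open>a = hd B\<close> contributes.\<close>
  moreover have "(\<Sum>a\<in>N. if B \<noteq> [] \<and> hd B = a then right_shifts (A @ [a]) (tl B) else 0)
      = right_shifts A B - frag_of (A, B)"
    using assms by (cases B) (auto simp: right_shifts_Nil right_shifts_Cons)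
  ultimately show ?thesis
    by (simp add: integral0_pd_frag_of sum_subtractf iota_at0_frag_of)
qed

text \<open>Fixing \<open>N\<close> in advance makes both sides additive in \<open>F\<close>; the
  set of labels with nonzero summand varies with \<open>F\<close> and would not suit the
  induction.\<close>

lemma expansion_finite:
  assumes "finite N" "Poly_Mapping.keys F \<subseteq> {(A, B). set A \<subseteq> N \<and> set B \<subseteq> N}"
  shows "F = iota (at0 F) + (\<Sum>a\<in>N. integral0 a (pd a F))"
  using assms(2)
proof (induction F rule: frag_induction)
  case zero
  then show ?case
    by (simp add: iota_def at0_def integral0_def pd_def)
next
  case (one x)
  then show ?case
    using expansion_frag_of[OF assms(1)] by blast
next
  case (diff F G)
  have "F - G = (iota (at0 F) + (\<Sum>a\<in>N. integral0 a (pd a F)))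
      - (iota (at0 G) + (\<Sum>a\<in>N. integral0 a (pd a G)))"
    using diff by simp
  also have "\<dots> = iota (at0 (F - G)) + (\<Sum>a\<in>N. integral0 a (pd a (F - G)))"
    by (simp add: iota_def at0_def integral0_def pd_def frag_extend_diff sum_subtractf)
  finally show ?case .
qed

lemma pd_eq_0:
  assumes "\<And>A B. (A, B) \<in> Poly_Mapping.keys F \<Longrightarrow> a \<notin> set A \<union> set B"
  shows "pd a F = 0"
  unfolding pd_def by (rule frag_extend_eq_0) (use assms in force)

theorem mainTheorem2:
  fixes L :: "'a set" and F :: "'a list \<times> 'a list \<Rightarrow>\<^sub>0 int"
  assumes "F \<in> carrier (RRr L)"
  shows "finite {a \<in> L. integral0 a (pd a F) \<noteq> 0} \<and>
    F = iota (at0 F) + (\<Sum>a\<in>{a \<in> L. integral0 a (pd a F) \<noteq> 0}. integral0 a (pd a F))"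
proof -
  \<comment> \<open>The labels occurring in \<open>F\<close>: finitely many, and all other
    derivatives vanish.\<close>
  define N where "N = (\<Union>(A, B)\<in>Poly_Mapping.keys F. set A \<union> set B)"
  have "finite N"
    unfolding N_def by auto
  have "N \<subseteq> L"
    using assms by (fastforce simp: N_def carrier_free_Abelian_group_iff rseqs_def seqs_def)
  have zero: "integral0 a (pd a F) = 0" if "a \<notin> N" for a
  proof -
    have "pd a F = 0"
      by (rule pd_eq_0) (use that in \<open>auto simp: N_def\<close>)
    then show ?thesis
      by (simp add: integral0_def)
  qed
  then have sub: "{a \<in> L. integral0 a (pd a F) \<noteq> 0} \<subseteq> N"
    by blast
  have "F = iota (at0 F) + (\<Sum>a\<in>N. integral0 a (pd a F))"
    using \<open>finite N\<close> by (rule expansion_finite) (auto simp: N_def)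
  also have "(\<Sum>a\<in>N. integral0 a (pd a F))
      = (\<Sum>a\<in>{a \<in> L. integral0 a (pd a F) \<noteq> 0}. integral0 a (pd a F))"
    using \<open>finite N\<close> sub \<open>N \<subseteq> L\<close> by (intro sum.mono_neutral_right) auto
  finally show ?thesis
    using sub \<open>finite N\<close> finite_subset by blast
qed

end
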